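(* For any integers $0\le t<T_0\le T$ and any $\mu\in\mathcal P_0(\mathbb S)$, $$\mathbb V_0(t,\mu)=\Big\{J(T_0,\psi;t,\mu,\alpha^*;\cdot,\alpha^* ):\ \psi\in\mathbb L^0(\mathbb S\times\mathcal P_0(\mathbb S);\mathbb R),\ \alpha^*\in\mathcal A_{state},\ \psi(\cdot,\mu^{\alpha^*}_{T_0})\in\mathbb V_0(T_0,\mu^{\alpha^*}_{T_0}),\ \alpha^*\in\mathcal M_{state}(T_0,\psi;t,\mu)\Big\},$$ where $\mu^{\alpha^*}$ is the flow of marginals started from $(t,\mu)$ under the control $\alpha^*$.
   Context: Setting (discrete mean field game). $\mathbb T=\{0,\dots,T\}$; $\mathbb S$ is a finite set with $|\mathbb S|=d$; $\mathcal P(\mathbb S)$ is the set of probability measures on $\mathbb S$ with the distance $W_1(\mu,\nu):=\sum_{x\in\mathbb S}|\mu(x)-\nu(x)|$; $\mathcal P_0(\mathbb S)\subset\mathcal P(\mathbb S)$ consists of measures with full support. $\mathbb A\subset\mathbb R^{d_0}$ is a measurable set. $q:\mathbb T\times\mathbb S\times\mathcal P(\mathbb S)\times\mathbb A\times\mathbb S\to(0,1)$ is a transition probability function: $\sum_{\tilde x\in\mathbb S}q(t,x,\mu,a;\tilde x)=1$. $F:\mathbb T\times\mathbb S\times\mathcal P(\mathbb S)\times\mathbb A\to\mathbb R$ and $G:\mathbb S\times\mathcal P(\mathbb S)\to\mathbb R$ are measurable with $\inf_{a\in\mathbb A}F(t,x,\mu,a)>-\infty$ for all $(t,x,\mu)$.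 $\mathbb L^0(E;\mathbb R)$ denotes the measurable functions $E\to\mathbb R$. $X$ is the canonical process on $\Omega=\mathbb S^{T+1}$. $\mathcal A_{state}$ is the set of all maps $\alpha:\mathbb T\times\mathbb S\to\mathbb A$. For $(t,\mu,\alpha)\in\mathbb T\times\mathcal P(\mathbb S)\times\mathcal A_{state}$, $\mathbb P^{t,\mu,\alpha}$ is the law of $(X_s)_{s\ge t}$ determined by $\mathbb P^{t,\mu,\alpha}\circ X_t^{-1}=\mu$ and $\mathbb P^{t,\mu,\alpha}(X_{s+1}=\tilde x|X_s=x)=q(s,x,\mu^\alpha_s,\alpha(s,x);\tilde x)$, where $\mu^\alpha_s:=\mathbb P^{t,\mu,\alpha}\circ X_s^{-1}$ (so $\mu^\alpha$ depends on $(t,\mu)$). For a flow $\{\mu_\cdot\}$, $x\in\mathbb S$ and $\tilde\alpha\in\mathcal A_{state}$, $\mathbb P^{\{\mu_\cdot\};t,x,\tilde\alpha}$ is determined by $X_t=x$ a.s. and $\mathbb P(X_{s+1}=\bar x|X_s=\tilde x)=q(s,\tilde x,\mu_s,\tilde\alpha(s,\tilde x);\bar x)$, $s\ge t$. Costs: $J(\{\mu_\cdot\};t,x,\tilde\alpha):=\mathbb E^{\mathbb P^{\{\mu_\cdot\};t,x,\tilde\alpha}}\big[G(X_T,\mu_T)+\sum_{r=t}^{T-1}F(r,X_r,\mu_r,\tilde\alpha(r,X_r))\big]$, $J(t,\mu,\alpha;x,\tilde\alpha):=J(\mu^\alpha;t,x,\tilde\alpha)$, $v(\{\mu_\cdot\};t,x):=\inf_{\tilde\alpha\in\mathcal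 A_{state}}J(\{\mu_\cdot\};t,x,\tilde\alpha)$. Equilibria and raw set value: for $\mu\in\mathcal P_0(\mathbb S)$, $\alpha^*\in\mathcal M_{state}(t,\mu)$ iff $\alpha^*\in\mathcal A_{state}$ and $J(t,\mu,\alpha^*;x,\alpha^* )=v(\mu^{\alpha^*};t,x)$ for all $x\in\mathbb S$; and $\mathbb V_0(t,\mu):=\{J(t,\mu,\alpha^*;\cdot,\alpha^* ):\alpha^*\in\mathcal M_{state}(t,\mu)\}\subset\mathbb L^0(\mathbb S;\mathbb R)$. Game on $\{t,\dots,T_0\}$: for $\psi\in\mathbb L^0(\mathbb S\times\mathcal P_0(\mathbb S);\mathbb R)$, $J(T_0,\psi;t,\mu,\alpha;x,\tilde\alpha):=\mathbb E^{\mathbb P^{\mu^\alpha;t,x,\tilde\alpha}}\big[\psi(X_{T_0},\mu^\alpha_{T_0})+\sum_{s=t}^{T_0-1}F(s,X_s,\mu^\alpha_s,\tilde\alpha(s,X_s))\big]$, and $\alpha^*\in\mathcal M_{state}(T_0,\psi;t,\mu)$ iff $\alpha^*\in\mathcal A_{state}$ and $J(T_0,\psi;t,\mu,\alpha^*;x,\alpha^* )=\inf_{\tilde\alpha\in\mathcal A_{state}}J(T_0,\psi;t,\mu,\alpha^*;x,\tilde\alpha)$ for all $x\in\mathbb S$. *)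

theory Defs
  imports "HOL-Probability.Probability"
begin

text \<open>
  The state space is the finite type \<open>'s\<close>, the time set is \<open>{0..T}\<close>, the probability measures on
  the state space are the elements of \<open>'s pmf\<close>, and the controls take values in a set
  \<open>A\<close> of vectors in \<open>real ^ 'n\<close>. The transition function \<open>q\<close> is
  curried: \<open>q t x \<mu> a\<close> is the law of the next state, so \<open>pmf (q t x \<mu> a) y\<close> is the probability
  of jumping from \<open>x\<close> to \<open>y\<close>, and these numbers sum to 1 over \<open>y\<close> by typing. All functions are total;
  their values for times beyond \<open>T\<close> or for actions outside \<open>A\<close> play no role.
\<close>

definition W1 :: "'s::finite pmf \<Rightarrow> 's pmf \<Rightarrow> real" where
  "W1 \<mu> \<nu> = (\<Sum>x\<in>UNIV. \<bar>pmf \<mu> x - pmf \<nu> x\<bar>)"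

lemma Metric_space_W1: "Metric_space UNIV (W1 :: 's::finite pmf \<Rightarrow> 's pmf \<Rightarrow> real)"
proof
  show "0 \<le> W1 \<mu> \<nu>" for \<mu> \<nu> :: "'s pmf"
    by (simp add: W1_def sum_nonneg)
  show "W1 \<mu> \<nu> = W1 \<nu> \<mu>" for \<mu> \<nu> :: "'s pmf"
    by (simp add: W1_def abs_minus_commute)
  show "W1 \<mu> \<nu> = 0 \<longleftrightarrow> \<mu> = \<nu>" for \<mu> \<nu> :: "'s pmf"
    by (auto simp: W1_def sum_nonneg_eq_0_iff intro: pmf_eqI)
  show "W1 \<mu> \<rho> \<le> W1 \<mu> \<nu> + W1 \<nu> \<rho>" for \<mu> \<nu> \<rho> :: "'s pmf"
    unfolding W1_def sum.distrib[symmetric] by (rule sum_mono) linarith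
qed

definition prob_borel :: "'s::finite pmf measure" where
  "prob_borel = sigma UNIV {U. openin (Metric_space.mtopology UNIV W1) U}"

definition P0 :: "'s::finite pmf set" where
  "P0 = {\<mu>. set_pmf \<mu> = UNIV}"

definition A_state :: "nat \<Rightarrow> 'a set \<Rightarrow> (nat \<Rightarrow> 's \<Rightarrow> 'a) set" where
  "A_state T A = {\<alpha>. \<forall>t\<le>T. \<forall>x. \<alpha> t x \<in> A}"

text \<open>
  \<open>path_law K t \<mu> n\<close> is the law of \<open>(X\<^sub>t, \<dots>, X\<^sub>t\<^sub>+\<^sub>n)\<close> for the Markov chain started from
  \<open>\<mu>\<close> at time \<open>t\<close>, whose transition law \<open>K s \<nu> x\<close> from state \<open>x\<close> at time \<open>s\<close> may depend on the law
  \<open>\<nu>\<close> of \<open>X\<^sub>s\<close>. A path is a function \<open>w\<close> on times with \<open>X\<^sub>s w = w s\<close>, left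
  \<open>undefined\<close> outside \<open>{t..t+n}\<close>. The lemmas \<open>mf_law_init\<close>, \<open>mf_law_transition\<close>,
  \<open>player_law_init\<close> and \<open>player_law_transition\<close> below show that the laws derived from it satisfy
  their characterizing equations.
\<close>

primrec path_law ::
  "(nat \<Rightarrow> 's pmf \<Rightarrow> 's \<Rightarrow> 's pmf) \<Rightarrow> nat \<Rightarrow> 's pmf \<Rightarrow> nat \<Rightarrow> (nat \<Rightarrow> 's) pmf" where
  "path_law K t \<mu> 0 = map_pmf (\<lambda>x. (\<lambda>_. undefined)(t := x)) \<mu>"
| "path_law K t \<mu> (Suc n) =
     bind_pmf (path_law K t \<mu> n)
       (\<lambda>w. map_pmf (\<lambda>y. w(Suc (t + n) := y))
         (K (t + n) (map_pmf (\<lambda>w'. w' (t + n)) (path_law K t \<mu> n)) (w (t + n))))"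

text \<open>The law of the state process, and its flow of marginals, when the whole population starts
  from \<open>\<mu>\<close> at time \<open>t\<close> and uses \<open>\<alpha>\<close>; the dynamics involve the process's own marginals.\<close>

definition mf_law ::
  "nat \<Rightarrow> (nat \<Rightarrow> 's \<Rightarrow> 's pmf \<Rightarrow> 'a \<Rightarrow> 's pmf) \<Rightarrow> nat \<Rightarrow> 's pmf \<Rightarrow> (nat \<Rightarrow> 's \<Rightarrow> 'a)
    \<Rightarrow> (nat \<Rightarrow> 's) pmf" where
  "mf_law T q t \<mu> \<alpha> = path_law (\<lambda>s \<nu> x. q s x \<nu> (\<alpha> s x)) t \<mu> (T - t)"

definition mf_flow ::
  "nat \<Rightarrow> (nat \<Rightarrow> 's \<Rightarrow> 's pmf \<Rightarrow> 'a \<Rightarrow> 's pmf) \<Rightarrow> nat \<Rightarrow> 's pmf \<Rightarrow> (nat \<Rightarrow> 's \<Rightarrow> 'a)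
    \<Rightarrow> nat \<Rightarrow> 's pmf" where
  "mf_flow T q t \<mu> \<alpha> s = map_pmf (\<lambda>w. w s) (mf_law T q t \<mu> \<alpha>)"

text \<open>The law of the state of a single player who starts from \<open>x\<close> at time \<open>t\<close> and uses \<open>\<alpha>\<close>, in a
  population whose flow \<open>m\<close> of distributions is given.\<close>

definition player_law ::
  "nat \<Rightarrow> (nat \<Rightarrow> 's \<Rightarrow> 's pmf \<Rightarrow> 'a \<Rightarrow> 's pmf) \<Rightarrow> (nat \<Rightarrow> 's pmf) \<Rightarrow> nat \<Rightarrow> 's
    \<Rightarrow> (nat \<Rightarrow> 's \<Rightarrow> 'a) \<Rightarrow> (nat \<Rightarrow> 's) pmf" where
  "player_law T q m t x \<alpha> =
     path_law (\<lambda>s _ y. q s y (m s) (\<alpha> s y)) t (return_pmf x) (T - t)"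

lemma path_law_marginal:
  assumes "k \<le> n"
  shows "map_pmf (\<lambda>w. w (t + k)) (path_law K t \<mu> n) =
         map_pmf (\<lambda>w. w (t + k)) (path_law K t \<mu> k)"
  using assms
proof (induction rule: dec_induct)
  case (step n)
  then show ?case
    by (simp add: map_bind_pmf pmf.map_comp o_def) (simp add: map_pmf_def bind_assoc_pmf)
qed simp

lemma path_law_init: "map_pmf (\<lambda>w. w t) (path_law K t \<mu> n) = \<mu>"
  using path_law_marginal[of 0 n t K \<mu>] by (simp add: pmf.map_comp o_def)

lemma path_law_joint:
  assumes "k < n"
  shows "map_pmf (\<lambda>w. (w (t + k), w (Suc (t + k)))) (path_law K t \<mu> n) =
         (let \<nu> = map_pmf (\<lambda>w. w (t + k)) (path_law K t \<mu> n)
          in bind_pmf \<nu> (\<lambda>x. map_pmf (Pair x) (K (t + k) \<nu> x)))"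
proof -
  have *: "map_pmf (\<lambda>w. (w (t + k), w (Suc (t + k)))) (path_law K t \<mu> n) =
           map_pmf (\<lambda>w. (w (t + k), w (Suc (t + k)))) (path_law K t \<mu> (Suc k))"
    using Suc_leI[OF assms]
  proof (induction rule: dec_induct)
    case (step n)
    then show ?case
      by (simp add: map_bind_pmf pmf.map_comp o_def del: path_law.simps(2) add: path_law.simps(2)[of _ _ _ n])
        (simp add: map_pmf_def bind_assoc_pmf)
  qed simp
  show ?thesis
    unfolding * path_law_marginal[OF less_imp_le[OF assms]] Let_def
    by (simp add: map_bind_pmf bind_map_pmf pmf.map_comp o_def)
qed

lemma path_law_transition:
  assumes "k < n"
  shows "measure_pmf.prob (path_law K t \<mu> n) {w. w (t + k) = x \<and> w (Suc (t + k)) = y} =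
         measure_pmf.prob (path_law K t \<mu> n) {w. w (t + k) = x} *
         pmf (K (t + k) (map_pmf (\<lambda>w. w (t + k)) (path_law K t \<mu> n)) x) y"
  (is "?L = ?M * pmf (K _ ?\<nu> x) y")
proof -
  have "?L = pmf (map_pmf (\<lambda>w. (w (t + k), w (Suc (t + k)))) (path_law K t \<mu> n)) (x, y)"
    by (simp add: pmf_map vimage_def)
  also have "\<dots> = pmf (bind_pmf ?\<nu> (\<lambda>x. map_pmf (Pair x) (K (t + k) ?\<nu> x))) (x, y)"
    by (simp only: path_law_joint[OF assms] Let_def)
  also have "\<dots> = measure_pmf.expectation ?\<nu> (\<lambda>z. indicator {x} z * pmf (K (t + k) ?\<nu> x) y)"
    unfolding pmf_bind
  proof (rule Bochner_Integration.integral_cong)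
    fix z
    show "pmf (map_pmf (Pair z) (K (t + k) ?\<nu> z)) (x, y) = indicator {x} z * pmf (K (t + k) ?\<nu> x) y"
    proof (cases "z = x")
      case True
      then show ?thesis using pmf_map_inj'[of "Pair x" _ y] by (simp add: inj_on_def)
    next
      case False
      then have "(x, y) \<notin> set_pmf (map_pmf (Pair z) (K (t + k) ?\<nu> z))" by auto
      then show ?thesis using False by (simp add: pmf_eq_0_set_pmf)
    qed
  qed simp
  also have "\<dots> = pmf ?\<nu> x * pmf (K (t + k) ?\<nu> x) y"
    by (simp add: pmf.rep_eq)
  also have "pmf ?\<nu> x = ?M"
    by (simp add: pmf_map vimage_def)
  finally show ?thesis .
qed

lemma mf_law_init: "mf_flow T q t \<mu> \<alpha> t = \<mu>"
  by (simp add: mf_flow_def mf_law_def path_law_init)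

lemma mf_law_transition:
  assumes "t \<le> s" "s < T"
  shows "measure_pmf.prob (mf_law T q t \<mu> \<alpha>) {w. w s = x \<and> w (Suc s) = y} =
         measure_pmf.prob (mf_law T q t \<mu> \<alpha>) {w. w s = x} *
         pmf (q s x (mf_flow T q t \<mu> \<alpha> s) (\<alpha> s x)) y"
  using path_law_transition[of "s - t" "T - t" "\<lambda>s \<nu> x. q s x \<nu> (\<alpha> s x)" t \<mu> x y] assms
  by (simp add: mf_law_def mf_flow_def)

lemma player_law_init: "map_pmf (\<lambda>w. w t) (player_law T q m t x \<alpha>) = return_pmf x"
  by (simp add: player_law_def path_law_init)

lemma player_law_transition:
  assumes "t \<le> s" "s < T"
  shows "measure_pmf.prob (player_law T q m t x \<alpha>) {w. w s = y \<and> w (Suc s) = z} =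
         measure_pmf.prob (player_law T q m t x \<alpha>) {w. w s = y} *
         pmf (q s y (m s) (\<alpha> s y)) z"
  using path_law_transition[of "s - t" "T - t" "\<lambda>s _ y. q s y (m s) (\<alpha> s y)" t "return_pmf x" y z] assms
  by (simp add: player_law_def)

text \<open>Costs, values and equilibria. The infima below are over sets of reals that are bounded below
  as soon as every \<open>F t x \<mu>\<close> is bounded below on \<open>A\<close>.\<close>

definition J_flow where
  "J_flow T q F G m t x \<alpha> =
     measure_pmf.expectation (player_law T q m t x \<alpha>)
       (\<lambda>w. G (w T) (m T) + (\<Sum>r = t..<T. F r (w r) (m r) (\<alpha> r (w r)) :: real))"

definition J where
  "J T q F G t \<mu> \<alpha> x \<alpha>' = J_flow T q F G (mf_flow T q t \<mu> \<alpha>) t x \<alpha>'"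

definition v where
  "v T A q F G m t x = (INF \<alpha>\<in>A_state T A. J_flow T q F G m t x \<alpha>)"

definition M_state where
  "M_state T A q F G t \<mu> =
     {\<alpha> \<in> A_state T A. \<forall>x. J T q F G t \<mu> \<alpha> x \<alpha> = v T A q F G (mf_flow T q t \<mu> \<alpha>) t x}"

definition V0 where
  "V0 T A q F G t \<mu> = {(\<lambda>x. J T q F G t \<mu> \<alpha> x \<alpha>) | \<alpha>. \<alpha> \<in> M_state T A q F G t \<mu>}"

text \<open>The game on \<open>{t..T0}\<close> with terminal cost \<open>\<psi>\<close>.\<close>

definition J_trunc where
  "J_trunc T q F T0 \<psi> t \<mu> \<alpha> x \<alpha>' =
     (let m = mf_flow T q t \<mu> \<alpha> in
      measure_pmf.expectation (player_law T q m t x \<alpha>')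
        (\<lambda>w. \<psi> (w T0) (m T0) + (\<Sum>s = t..<T0. F s (w s) (m s) (\<alpha>' s (w s)) :: real)))"

definition M_state_trunc where
  "M_state_trunc T A q F T0 \<psi> t \<mu> =
     {\<alpha> \<in> A_state T A. \<forall>x. J_trunc T q F T0 \<psi> t \<mu> \<alpha> x \<alpha> =
        (INF \<alpha>'\<in>A_state T A. J_trunc T q F T0 \<psi> t \<mu> \<alpha> x \<alpha>')}"

definition L0_terminal :: "('s::finite \<Rightarrow> 's pmf \<Rightarrow> real) set" where
  "L0_terminal = {\<psi>. (\<lambda>(x, \<mu>). \<psi> x \<mu>)
     \<in> borel_measurable (count_space UNIV \<Otimes>\<^sub>M restrict_space prob_borel P0)}"

end

theory Submission
  imports Defs
begin

text \<open>
  With the flow of marginals frozen, a player faces an ordinary finite-horizon control problem, whose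
  cost is an iterated one-step operator and hence splits at \<open>T0\<close>. Given an equilibrium \<open>\<alpha>\<close> on
  \<open>{t..T}\<close>, take \<open>\<psi>\<close> to be its cost from \<open>T0\<close>, constant in the measure argument. Optimality of \<open>\<alpha>\<close>
  from \<open>T0\<close> is the point where \<open>q > 0\<close> enters: two controls can be combined into one that is at least
  as good as both from every state, so a control beating \<open>\<alpha>\<close> at one state at time \<open>T0\<close> yields one
  that is nowhere worse there; as every state is reached with positive probability, using it after
  \<open>T0\<close> strictly improves on \<open>\<alpha>\<close> from time \<open>t\<close>. Conversely, an equilibrium of the truncated
  game followed by the equilibrium from \<open>T0\<close> realizing \<open>\<psi>\<close> is an equilibrium on \<open>{t..T}\<close>.
\<close>

section \<open>The cost to go as an iterated one-step operator\<close>

text \<open>The flow \<open>m\<close> is an argument separate from \<open>\<alpha>\<close>: a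
  deviating player does not move the population.\<close>

definition one_step_cost ::
  "(nat \<Rightarrow> 's::finite \<Rightarrow> 's pmf \<Rightarrow> 'a \<Rightarrow> 's pmf) \<Rightarrow> (nat \<Rightarrow> 's \<Rightarrow> 's pmf \<Rightarrow> 'a \<Rightarrow> real)
    \<Rightarrow> (nat \<Rightarrow> 's pmf) \<Rightarrow> (nat \<Rightarrow> 's \<Rightarrow> 'a) \<Rightarrow> nat \<Rightarrow> ('s \<Rightarrow> real) \<Rightarrow> 's \<Rightarrow> real" where
  "one_step_cost q F m \<alpha> s h y =
     F s y (m s) (\<alpha> s y) + (\<Sum>z\<in>UNIV. pmf (q s y (m s) (\<alpha> s y)) z * h z)"

text \<open>The recursion peels off the last time step, just as \<open>path_law\<close> appends the
  last state; this makes the link with expectations an induction on \<open>n\<close> with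
  \<open>h\<close> arbitrary. The backward Bellman form is recovered in
  \<open>cost_Suc_first\<close>.\<close>

primrec cost ::
  "(nat \<Rightarrow> 's::finite \<Rightarrow> 's pmf \<Rightarrow> 'a \<Rightarrow> 's pmf) \<Rightarrow> (nat \<Rightarrow> 's \<Rightarrow> 's pmf \<Rightarrow> 'a \<Rightarrow> real)
    \<Rightarrow> (nat \<Rightarrow> 's pmf) \<Rightarrow> (nat \<Rightarrow> 's \<Rightarrow> 'a) \<Rightarrow> nat \<Rightarrow> nat \<Rightarrow> ('s \<Rightarrow> real) \<Rightarrow> 's \<Rightarrow> real" where
  "cost q F m \<alpha> t 0 h = h"
| "cost q F m \<alpha> t (Suc n) h = cost q F m \<alpha> t n (one_step_cost q F m \<alpha> (t + n) h)"

lemma cost_add: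
  "cost q F m \<alpha> t (k + n) h = cost q F m \<alpha> t k (cost q F m \<alpha> (t + k) n h)"
  by (induction n arbitrary: h) (simp_all add: add.assoc)

lemma cost_split:
  assumes "t \<le> s" "s \<le> u"
  shows "cost q F m \<alpha> t (u - t) h = cost q F m \<alpha> t (s - t) (cost q F m \<alpha> s (u - s) h)"
  using cost_add[of q F m \<alpha> t "s - t" "u - s" h] assms by simp

lemma cost_Suc_first:
  "cost q F m \<alpha> t (Suc n) h = one_step_cost q F m \<alpha> t (cost q F m \<alpha> (Suc t) n h)"
  using cost_add[of q F m \<alpha> t 1 n h] by simp

lemma cost_cong:
  assumes "\<And>s. t \<le> s \<Longrightarrow> s < t + n \<Longrightarrow> m s = m' s"
    and "\<And>s. t \<le> s \<Longrightarrow> s < t + n \<Longrightarrow> \<alpha> s = \<alpha>' s"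
  shows "cost q F m \<alpha> t n h = cost q F m' \<alpha>' t n h"
  using assms
proof (induction n arbitrary: h)
  case (Suc n)
  have "one_step_cost q F m \<alpha> (t + n) h = one_step_cost q F m' \<alpha>' (t + n) h"
    using Suc.prems by (simp add: one_step_cost_def fun_eq_iff)
  with Suc show ?case by simp
qed simp

lemma one_step_cost_mono:
  assumes "\<And>y. h y \<le> h' y"
  shows "one_step_cost q F m \<alpha> s h y \<le> one_step_cost q F m \<alpha> s h' y"
  unfolding one_step_cost_def by (intro add_left_mono sum_mono mult_left_mono assms) simp

lemma cost_mono:
  assumes "\<And>y. h y \<le> h' y"
  shows "cost q F m \<alpha> t n h x \<le> cost q F m \<alpha> t n h' x"
  using assms by (induction n arbitrary: h h') (simp_all add: one_step_cost_mono)

lemma one_step_cost_strict_mono: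
  assumes le: "\<And>y. h y \<le> h' y" and less: "h z < h' z"
    and pos: "pmf (q s y (m s) (\<alpha> s y)) z > 0"
  shows "one_step_cost q F m \<alpha> s h y < one_step_cost q F m \<alpha> s h' y"
  unfolding one_step_cost_def
proof (intro add_strict_left_mono sum_strict_mono_ex1 ballI)
  show "\<exists>z\<in>UNIV. pmf (q s y (m s) (\<alpha> s y)) z * h z < pmf (q s y (m s) (\<alpha> s y)) z * h' z"
    using mult_strict_left_mono[OF less pos] by blast
qed (auto intro: mult_left_mono le)

text \<open>One step with positive transition probabilities spreads a strict inequality at the
  single state \<open>z\<close> to every state, and the earlier steps preserve it.
  \<open>n > 0\<close> guarantees that there is such a step.\<close>

lemma cost_strict_mono:
  assumes "\<And>y. h y \<le> h' y" and "h z < h' z" and "n > 0"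
    and pos: "\<And>s y z. t \<le> s \<Longrightarrow> s < t + n \<Longrightarrow> pmf (q s y (m s) (\<alpha> s y)) z > 0"
  shows "cost q F m \<alpha> t n h x < cost q F m \<alpha> t n h' x"
  using assms
proof (induction n arbitrary: h h' z)
  case (Suc n)
  have less: "one_step_cost q F m \<alpha> (t + n) h y < one_step_cost q F m \<alpha> (t + n) h' y" for y
    using Suc.prems by (intro one_step_cost_strict_mono[of h h' z]) auto
  show ?case
  proof (cases "n = 0")
    case False
    then show ?thesis
      using Suc.prems(4) by (simp add: Suc.IH[OF less_imp_le less] less)
  qed (use less in simp)
qed simp

section \<open>Uniform lower bounds and the combination of two controls\<close>

text \<open>Makes the infima over controls genuine, since \<open>INF\<close> on reals says nothing
  useful for sets unbounded below. Each step lowers the bound by at most a fixed amount, as there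
  are finitely many states.\<close>

lemma cost_bounded_below:
  fixes F :: "nat \<Rightarrow> 's::finite \<Rightarrow> 's pmf \<Rightarrow> 'a \<Rightarrow> real" and h :: "'s \<Rightarrow> real"
  assumes bdd: "\<forall>s\<le>T. \<forall>x \<nu>. bdd_below (F s x \<nu> ` A)" and n: "t + n \<le> T"
  shows "\<exists>c. \<forall>\<alpha>\<in>A_state T A. \<forall>x. c \<le> cost q F m \<alpha> t n h x"
proof -
  \<comment> \<open>The recursion replaces \<open>h\<close> by a function that depends on
    \<open>\<alpha>\<close>, so the induction needs a \<open>c\<close> that depends on
    \<open>h\<close> only through its lower bound \<open>b\<close>.\<close>
  have "\<exists>c. \<forall>\<alpha>\<in>A_state T A. \<forall>h. (\<forall>y. b \<le> h y) \<longrightarrow> (\<forall>x. c \<le> cost q F m \<alpha> t n h x)" for b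
    using n
  proof (induction n arbitrary: b)
    case (Suc n)
    have "\<forall>y. \<exists>B. \<forall>a\<in>A. B \<le> F (t + n) y (m (t + n)) a"
      using bdd Suc.prems by (auto simp: bdd_below_def)
    then obtain B where B: "\<And>y a. a \<in> A \<Longrightarrow> B y \<le> F (t + n) y (m (t + n)) a"
      by metis
    have step: "Min (range B) + b \<le> one_step_cost q F m \<alpha> (t + n) h y"
      if "\<alpha> \<in> A_state T A" "\<forall>y. b \<le> h y" for \<alpha> h y
    proof -
      have "Min (range B) \<le> B y" by simp
      also have "B y \<le> F (t + n) y (m (t + n)) (\<alpha> (t + n) y)"
        using that Suc.prems by (intro B) (auto simp: A_state_def)
      finally have "Min (range B) \<le> F (t + n) y (m (t + n)) (\<alpha> (t + n) y)" .
      moreover have "b = (\<Sum>z\<in>UNIV. pmf (q (t + n) y (m (t + n)) (\<alpha> (t + n) y)) z * b)"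
        by (simp add: sum_distrib_right[symmetric] sum_pmf_eq_1)
      moreover have "\<dots> \<le> (\<Sum>z\<in>UNIV. pmf (q (t + n) y (m (t + n)) (\<alpha> (t + n) y)) z * h z)"
        using that by (intro sum_mono mult_left_mono) auto
      ultimately show ?thesis by (simp add: one_step_cost_def)
    qed
    from Suc.IH[of "Min (range B) + b"] Suc.prems obtain c where
      c: "\<forall>\<alpha>\<in>A_state T A. \<forall>h. (\<forall>y. Min (range B) + b \<le> h y) \<longrightarrow>
        (\<forall>x. c \<le> cost q F m \<alpha> t n h x)" by auto
    then show ?case using step by (intro exI[of _ c]) simp
  qed auto
  from this[of "Min (range h)"] obtain c where
    "\<forall>\<alpha>\<in>A_state T A. \<forall>h'. (\<forall>y. Min (range h) \<le> h' y) \<longrightarrow>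
      (\<forall>x. c \<le> cost q F m \<alpha> t n h' x)" by blast
  then show ?thesis by (intro exI[of _ c]) simp
qed

text \<open>The combined control follows, at each time and state, the one with the lower cost to go.\<close>

lemma cost_improvement:
  assumes "\<alpha> \<in> A_state T A" "\<beta> \<in> A_state T A"
  obtains \<gamma> where "\<gamma> \<in> A_state T A"
    and "\<And>s x. s \<le> u \<Longrightarrow> cost q F m \<gamma> s (u - s) h x
      \<le> min (cost q F m \<alpha> s (u - s) h x) (cost q F m \<beta> s (u - s) h x)"
proof
  define \<gamma> where "\<gamma> s y =
    (if cost q F m \<alpha> s (u - s) h y \<le> cost q F m \<beta> s (u - s) h y then \<alpha> s y else \<beta> s y)" for s y
  show "\<gamma> \<in> A_state T A"
    using assms by (auto simp: A_state_def \<gamma>_def)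
  fix s x assume "s \<le> u"
  then show "cost q F m \<gamma> s (u - s) h x
      \<le> min (cost q F m \<alpha> s (u - s) h x) (cost q F m \<beta> s (u - s) h x)"
  proof (induction arbitrary: x rule: inc_induct)
    case (step s)
    \<comment> \<open>\<open>\<delta>\<close> is one of the two controls at all times, chosen by the
      comparison at this one \<open>s\<close> and \<open>x\<close>. It acts like
      \<open>\<gamma>\<close> there, and the induction hypothesis bounds the later cost of
      \<open>\<gamma>\<close> by its own.\<close>
    define \<delta> where "\<delta> = (if cost q F m \<alpha> s (u - s) h x \<le> cost q F m \<beta> s (u - s) h x then \<alpha> else \<beta>)"
    have u: "u - s = Suc (u - Suc s)" using step.hyps by simp
    have "cost q F m \<gamma> s (u - s) h x = one_step_cost q F m \<gamma> s (cost q F m \<gamma> (Suc s) (u - Suc s) h) x"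
      by (simp only: u cost_Suc_first)
    also have "\<dots> = one_step_cost q F m \<delta> s (cost q F m \<gamma> (Suc s) (u - Suc s) h) x"
      by (simp add: one_step_cost_def \<gamma>_def \<delta>_def)
    also have "\<dots> \<le> one_step_cost q F m \<delta> s (cost q F m \<delta> (Suc s) (u - Suc s) h) x"
      using step.IH by (intro one_step_cost_mono) (auto simp: \<delta>_def)
    also have "\<dots> = cost q F m \<delta> s (u - s) h x"
      by (simp only: u cost_Suc_first)
    also have "\<dots> = min (cost q F m \<alpha> s (u - s) h x) (cost q F m \<beta> s (u - s) h x)"
      by (simp add: \<delta>_def min_def)
    finally show ?case .
  qed simp
qed

section \<open>Expected costs under path laws\<close>

lemma finite_set_path_law:
  "finite (set_pmf (path_law K t (\<mu> :: 's::finite pmf) n))"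
  by (induction n) auto

lemma path_law_expectation_Suc:
  fixes K :: "nat \<Rightarrow> 's::finite pmf \<Rightarrow> 's \<Rightarrow> 's pmf" and g :: "(nat \<Rightarrow> 's) \<Rightarrow> real"
  shows "measure_pmf.expectation (path_law K t \<mu> (Suc n)) g =
    measure_pmf.expectation (path_law K t \<mu> n) (\<lambda>w. \<Sum>z\<in>UNIV.
      pmf (K (t + n) (map_pmf (\<lambda>w'. w' (t + n)) (path_law K t \<mu> n)) (w (t + n))) z
        * g (w(Suc (t + n) := z)))"
  unfolding path_law.simps
  by (subst pmf_expectation_bind[OF finite_set_path_law])
    (auto simp: integral_measure_pmf_real[OF finite_set_path_law] integral_measure_pmf_real[of UNIV]
       mult.commute intro!: sum.cong)

text \<open>\<open>player_law\<close> always runs to \<open>T\<close>; this discards the times after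
  the horizon of a truncated game.\<close>

lemma path_law_map_restrict:
  assumes "k \<le> n" and g: "\<And>w j y. k \<le> j \<Longrightarrow> g (w(Suc (t + j) := y)) = g w"
  shows "map_pmf g (path_law K t \<mu> n) = map_pmf g (path_law K t \<mu> k)"
  using assms(1)
proof (induction rule: dec_induct)
  case (step n)
  then show ?case
    using g[OF step.hyps(1)] by (simp add: map_bind_pmf pmf.map_comp o_def) (simp add: map_pmf_def)
qed simp

text \<open>Integrating out the last state turns the terminal cost \<open>h\<close>, together with
  the running cost at \<open>t + n\<close>, into \<open>one_step_cost\<close> at
  \<open>t + n\<close>, which is the terminal cost for the induction hypothesis.\<close>

lemma expectation_path_law:
  fixes h :: "'s::finite \<Rightarrow> real"
  shows "measure_pmf.expectation (path_law (\<lambda>s _ y. q s y (m s) (\<alpha> s y)) t (return_pmf x) n)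
      (\<lambda>w. h (w (t + n)) + (\<Sum>r = t..<t + n. F r (w r) (m r) (\<alpha> r (w r)))) =
    cost q F m \<alpha> t n h x"
proof (induction n arbitrary: h)
  case (Suc n)
  have "(\<Sum>z\<in>UNIV. pmf (q (t + n) (w (t + n)) (m (t + n)) (\<alpha> (t + n) (w (t + n)))) z *
      (h ((w(Suc (t + n) := z)) (t + Suc n)) + (\<Sum>r = t..<t + Suc n.
        F r ((w(Suc (t + n) := z)) r) (m r) (\<alpha> r ((w(Suc (t + n) := z)) r))))) =
    one_step_cost q F m \<alpha> (t + n) h (w (t + n))
      + (\<Sum>r = t..<t + n. F r (w r) (m r) (\<alpha> r (w r)))" for w
  proof -
    \<comment> \<open>The running costs stop at time \<open>t + n\<close>, so they do not see the
      update at \<open>Suc (t + n)\<close>.\<close>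
    have *: "(\<Sum>r = t..<t + Suc n.
        F r ((w(Suc (t + n) := z)) r) (m r) (\<alpha> r ((w(Suc (t + n) := z)) r))) =
      (\<Sum>r = t..<t + Suc n. F r (w r) (m r) (\<alpha> r (w r)))" for z
      by (rule sum.cong) auto
    show ?thesis
      unfolding *
      by (simp add: one_step_cost_def distrib_left sum.distrib sum_distrib_right[symmetric]
        sum_pmf_eq_1)
  qed
  then show ?case
    using Suc.IH[of "one_step_cost q F m \<alpha> (t + n) h"]
    unfolding path_law_expectation_Suc by simp
qed simp

lemma expectation_player_law:
  fixes h :: "'s::finite \<Rightarrow> real"
  assumes "t \<le> u" "u \<le> T"
  shows "measure_pmf.expectation (player_law T q m t x \<alpha>)
      (\<lambda>w. h (w u) + (\<Sum>r = t..<u. F r (w r) (m r) (\<alpha> r (w r)))) =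
    cost q F m \<alpha> t (u - t) h x"
proof -
  define g where "g w = h (w u) + (\<Sum>r = t..<u. F r (w r) (m r) (\<alpha> r (w r)))" for w
  define L where "L = path_law (\<lambda>s _ y. q s y (m s) (\<alpha> s y)) t (return_pmf x)"
  have "map_pmf g (L (T - t)) = map_pmf g (L (u - t))"
    unfolding L_def using assms by (intro path_law_map_restrict) (auto simp: g_def intro!: sum.cong)
  \<comment> \<open>Expectations of \<open>g\<close> are read as means of its image law, where the
    equality of laws applies.\<close>
  then have "measure_pmf.expectation (map_pmf g (L (T - t))) (\<lambda>x. x) =
      measure_pmf.expectation (map_pmf g (L (u - t))) (\<lambda>x. x)"
    by simp
  then show ?thesis
    using expectation_path_law[of q m \<alpha> t x "u - t" h F] assms
    by (simp add: player_law_def g_def L_def)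
qed

lemma J_flow_eq_cost:
  assumes "t \<le> T"
  shows "J_flow T q F G m t x \<alpha> = cost q F m \<alpha> t (T - t) (\<lambda>y. G y (m T)) x"
  unfolding J_flow_def
  using expectation_player_law[OF assms order_refl, of q m x \<alpha> "\<lambda>y. G y (m T)" F] by simp

lemma J_trunc_eq_cost:
  assumes "t \<le> u" "u \<le> T"
  shows "J_trunc T q F u \<psi> t \<mu> \<alpha> x \<alpha>' = cost q F (mf_flow T q t \<mu> \<alpha>) \<alpha>' t (u - t)
    (\<lambda>y. \<psi> y (mf_flow T q t \<mu> \<alpha> u)) x"
  unfolding J_trunc_def Let_def
  using expectation_player_law[OF assms, of q "mf_flow T q t \<mu> \<alpha>" x \<alpha>'
    "\<lambda>y. \<psi> y (mf_flow T q t \<mu> \<alpha> u)" F] by simp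

section \<open>Equilibria as systems of inequalities between costs\<close>

lemma cost_eq_INF_iff:
  fixes F :: "nat \<Rightarrow> 's::finite \<Rightarrow> 's pmf \<Rightarrow> 'a \<Rightarrow> real" and h :: "'s \<Rightarrow> real"
  assumes bdd: "\<forall>s\<le>T. \<forall>x \<nu>. bdd_below (F s x \<nu> ` A)" and n: "t + n \<le> T"
    and \<alpha>: "\<alpha> \<in> A_state T A"
  shows "cost q F m \<alpha> t n h x = (INF \<beta>\<in>A_state T A. cost q F m \<beta> t n h x) \<longleftrightarrow>
    (\<forall>\<beta>\<in>A_state T A. cost q F m \<alpha> t n h x \<le> cost q F m \<beta> t n h x)"
proof -
  from cost_bounded_below[OF bdd n, where q = q and m = m and h = h] obtain c
    where "\<forall>\<beta>\<in>A_state T A. \<forall>x. c \<le> cost q F m \<beta> t n h x" by auto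
  then have "bdd_below ((\<lambda>\<beta>. cost q F m \<beta> t n h x) ` A_state T A)"
    by (intro bdd_belowI2) blast
  then show ?thesis
    using \<alpha> by (auto intro!: antisym cINF_greatest cINF_lower)
qed

text \<open>The flow \<open>m\<close> generated by \<open>\<alpha>\<close> stays on both sides of
  the inequality, so the fixed-point aspect is confined to the equation for
  \<open>m\<close>.\<close>

lemma M_state_iff:
  fixes F :: "nat \<Rightarrow> 's::finite \<Rightarrow> 's pmf \<Rightarrow> 'a \<Rightarrow> real"
  assumes bdd: "\<forall>s\<le>T. \<forall>x \<nu>. bdd_below (F s x \<nu> ` A)" and t: "t \<le> T"
    and m: "m = mf_flow T q t \<mu> \<alpha>"
  shows "\<alpha> \<in> M_state T A q F G t \<mu> \<longleftrightarrow> \<alpha> \<in> A_state T A \<and>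
    (\<forall>x. \<forall>\<beta>\<in>A_state T A. cost q F m \<alpha> t (T - t) (\<lambda>y. G y (m T)) x
      \<le> cost q F m \<beta> t (T - t) (\<lambda>y. G y (m T)) x)"
  using cost_eq_INF_iff[OF bdd, where n = "T - t"] t
  by (auto simp: M_state_def J_def v_def J_flow_eq_cost m)

lemma M_state_trunc_iff:
  fixes F :: "nat \<Rightarrow> 's::finite \<Rightarrow> 's pmf \<Rightarrow> 'a \<Rightarrow> real"
  assumes bdd: "\<forall>s\<le>T. \<forall>x \<nu>. bdd_below (F s x \<nu> ` A)" and u: "t \<le> u" "u \<le> T"
    and m: "m = mf_flow T q t \<mu> \<alpha>"
  shows "\<alpha> \<in> M_state_trunc T A q F u \<psi> t \<mu> \<longleftrightarrow> \<alpha> \<in> A_state T A \<and>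
    (\<forall>x. \<forall>\<beta>\<in>A_state T A. cost q F m \<alpha> t (u - t) (\<lambda>y. \<psi> y (m u)) x
      \<le> cost q F m \<beta> t (u - t) (\<lambda>y. \<psi> y (m u)) x)"
  using cost_eq_INF_iff[OF bdd, where n = "u - t"] u
  by (auto simp: M_state_trunc_def J_trunc_eq_cost m)

section \<open>Flows of marginals as forward recursions\<close>

lemma mf_flow_Suc:
  assumes "t \<le> s" "s < T"
  shows "mf_flow T q t \<mu> \<alpha> (Suc s) =
    bind_pmf (mf_flow T q t \<mu> \<alpha> s) (\<lambda>x. q s x (mf_flow T q t \<mu> \<alpha> s) (\<alpha> s x))"
proof -
  have "mf_flow T q t \<mu> \<alpha> (Suc s) =
    map_pmf snd (map_pmf (\<lambda>w. (w (t + (s - t)), w (Suc (t + (s - t))))) (mf_law T q t \<mu> \<alpha>))"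
    using assms by (simp add: mf_flow_def pmf.map_comp o_def)
  also have "\<dots> = bind_pmf (mf_flow T q t \<mu> \<alpha> s) (\<lambda>x. q s x (mf_flow T q t \<mu> \<alpha> s) (\<alpha> s x))"
    unfolding mf_law_def
    by (subst path_law_joint)
      (use assms in \<open>auto simp: mf_flow_def mf_law_def Let_def map_bind_pmf pmf.map_comp o_def\<close>)
  finally show ?thesis .
qed

text \<open>The initial law and the recursion determine the flow. This identifies flows restarted at
  \<open>T0\<close> and flows of controls glued at \<open>T0\<close>.\<close>

lemma mf_flow_unique:
  assumes "s \<le> u" "u \<le> T" "m s = \<mu>"
    and "\<And>r. s \<le> r \<Longrightarrow> r < u \<Longrightarrow> m (Suc r) = bind_pmf (m r) (\<lambda>x. q r x (m r) (\<alpha> r x))"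
  shows "mf_flow T q s \<mu> \<alpha> u = m u"
  using assms
proof (induction rule: dec_induct)
  case (step n)
  then show ?case by (simp add: mf_flow_Suc)
qed (simp add: mf_law_init)


section \<open>Dynamic programming for the set value\<close>

theorem theorem2p4:
  fixes T t T0 :: nat
    and A :: "(real ^ 'n) set"
    and q :: "nat \<Rightarrow> 's::finite \<Rightarrow> 's pmf \<Rightarrow> real ^ 'n \<Rightarrow> 's pmf"
    and F :: "nat \<Rightarrow> 's \<Rightarrow> 's pmf \<Rightarrow> real ^ 'n \<Rightarrow> real"
    and G :: "'s \<Rightarrow> 's pmf \<Rightarrow> real"
    and \<mu> :: "'s pmf"
  assumes A_meas: "A \<in> sets borel"
    and q_range: "\<And>s x \<nu> a y. s \<le> T \<Longrightarrow> a \<in> A \<Longrightarrow> pmf (q s x \<nu> a) y \<in> {0<..<1}"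
    and F_meas: "(\<lambda>(s, x, \<nu>, a). F s x \<nu> a) \<in> borel_measurable
      (count_space {0..T} \<Otimes>\<^sub>M count_space UNIV \<Otimes>\<^sub>M prob_borel \<Otimes>\<^sub>M restrict_space borel A)"
    and G_meas: "(\<lambda>(x, \<nu>). G x \<nu>) \<in> borel_measurable (count_space UNIV \<Otimes>\<^sub>M prob_borel)"
    and F_bdd: "\<And>s x \<nu>. s \<le> T \<Longrightarrow> bdd_below (F s x \<nu> ` A)"
    and times: "t < T0" "T0 \<le> T"
    and \<mu>: "\<mu> \<in> P0"
  shows "V0 T A q F G t \<mu> =
    {(\<lambda>x. J_trunc T q F T0 \<psi> t \<mu> \<alpha> x \<alpha>) | \<psi> \<alpha>.
       \<psi> \<in> L0_terminal \<and> \<alpha> \<in> A_state T A \<and>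
       (\<lambda>x. \<psi> x (mf_flow T q t \<mu> \<alpha> T0)) \<in> V0 T A q F G T0 (mf_flow T q t \<mu> \<alpha> T0) \<and>
       \<alpha> \<in> M_state_trunc T A q F T0 \<psi> t \<mu>}"
proof (intro equalityI subsetI)
  have T0: "t \<le> T0" "t \<le> T" using times by auto
  have bdd: "\<forall>s\<le>T. \<forall>x \<nu>. bdd_below (F s x \<nu> ` A)" using F_bdd by simp
  {
    fix f assume "f \<in> V0 T A q F G t \<mu>"
    then obtain \<alpha> where f: "f = (\<lambda>x. J T q F G t \<mu> \<alpha> x \<alpha>)" and "\<alpha> \<in> M_state T A q F G t \<mu>"
      by (auto simp: V0_def)
    define m where "m = mf_flow T q t \<mu> \<alpha>"
    define m0 where "m0 = mf_flow T q T0 (m T0) \<alpha>"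
    define g where "g = (\<lambda>y. G y (m T))"
    define h where "h = cost q F m \<alpha> T0 (T - T0) g"
    define \<psi> :: "'s \<Rightarrow> 's pmf \<Rightarrow> real" where "\<psi> = (\<lambda>x _. h x)"
    have \<alpha>: "\<alpha> \<in> A_state T A" and opt:
      "\<And>x \<beta>. \<beta> \<in> A_state T A \<Longrightarrow> cost q F m \<alpha> t (T - t) g x \<le> cost q F m \<beta> t (T - t) g x"
      using \<open>\<alpha> \<in> M_state T A q F G t \<mu>\<close> M_state_iff[OF bdd T0(2) m_def, where G = G]
      by (auto simp: g_def)
    \<comment> \<open>Restarting the population at \<open>T0\<close> from its current law, with the
      same control, continues the original flow.\<close>
    have m0: "m0 s = m s" if "T0 \<le> s" "s \<le> T" for s
      unfolding m0_def using that T0 by (intro mf_flow_unique) (auto simp: m_def mf_flow_Suc)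
    have m0_cost: "cost q F m0 \<beta> T0 (T - T0) g = cost q F m \<beta> T0 (T - T0) g" for \<beta>
      using m0 by (intro cost_cong) auto
    \<comment> \<open>Following \<open>\<beta>\<close> before \<open>T0\<close> and
      \<open>\<gamma>\<close> afterwards is itself an admissible deviation, so optimality of
      \<open>\<alpha>\<close> applies to it.\<close>
    have splice: "cost q F m \<alpha> t (T - t) g x \<le>
        cost q F m \<beta> t (T0 - t) (cost q F m \<gamma> T0 (T - T0) g) x"
      if "\<beta> \<in> A_state T A" "\<gamma> \<in> A_state T A" for \<beta> \<gamma> x
    proof -
      define \<delta> where "\<delta> s = (if s < T0 then \<beta> s else \<gamma> s)" for s
      have "cost q F m \<alpha> t (T - t) g x \<le> cost q F m \<delta> t (T - t) g x"
        using that by (intro opt) (auto simp: \<delta>_def A_state_def)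
      also have "\<dots> = cost q F m \<delta> t (T0 - t) (cost q F m \<delta> T0 (T - T0) g) x"
        by (simp only: cost_split[OF T0(1) times(2)])
      also have "cost q F m \<delta> T0 (T - T0) g = cost q F m \<gamma> T0 (T - T0) g"
        by (intro cost_cong) (auto simp: \<delta>_def)
      also have "cost q F m \<delta> t (T0 - t) \<dots> = cost q F m \<beta> t (T0 - t) \<dots>"
        by (intro cost_cong) (auto simp: \<delta>_def)
      finally show ?thesis .
    qed
    have split: "cost q F m \<alpha> t (T - t) g = cost q F m \<alpha> t (T0 - t) h"
      unfolding h_def by (simp only: cost_split[OF T0(1) times(2)])
    have later: "h x \<le> cost q F m \<beta> T0 (T - T0) g x" if \<beta>: "\<beta> \<in> A_state T A" for \<beta> x
    proof (rule ccontr)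
      assume worse: "\<not> ?thesis"
      \<comment> \<open>\<open>\<beta>\<close> may be worse than \<open>\<alpha>\<close> at states
        other than \<open>x\<close>, so it cannot be used directly after \<open>T0\<close>.\<close>
      from cost_improvement[OF \<alpha> \<beta>] obtain \<gamma> where \<gamma>: "\<gamma> \<in> A_state T A" and
        "\<And>s x. s \<le> T \<Longrightarrow> cost q F m \<gamma> s (T - s) g x
          \<le> min (cost q F m \<alpha> s (T - s) g x) (cost q F m \<beta> s (T - s) g x)" by metis
      then have min: "cost q F m \<gamma> T0 (T - T0) g y \<le> min (h y) (cost q F m \<beta> T0 (T - T0) g y)" for y
        using times by (simp add: h_def)
      have "cost q F m \<gamma> T0 (T - T0) g y \<le> h y" for y
        using min[of y] by simp
      moreover have "cost q F m \<gamma> T0 (T - T0) g x < h x"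
        using min[of x] worse by simp
      ultimately have "cost q F m \<alpha> t (T0 - t) (cost q F m \<gamma> T0 (T - T0) g) x
          < cost q F m \<alpha> t (T0 - t) h x"
        using times \<alpha> q_range by (intro cost_strict_mono) (auto simp: A_state_def)
      with splice[OF \<alpha> \<gamma>, of x] show False by (simp add: split)
    qed
    have "\<psi> \<in> L0_terminal"
      unfolding L0_terminal_def \<psi>_def mem_Collect_eq by measurable
    moreover have "(\<lambda>x. \<psi> x (m T0)) \<in> V0 T A q F G T0 (m T0)"
    proof -
      have "\<alpha> \<in> M_state T A q F G T0 (m T0)"
        unfolding M_state_iff[OF bdd times(2) m0_def]
        using \<alpha> later m0[OF times(2) order_refl] m0_cost by (simp add: h_def g_def)
      moreover have "(\<lambda>x. \<psi> x (m T0)) = (\<lambda>x. J T q F G T0 (m T0) \<alpha> x \<alpha>)"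
        using m0[OF times(2) order_refl] m0_cost times
        by (simp add: J_def J_flow_eq_cost \<psi>_def h_def flip: m0_def g_def)
      ultimately show ?thesis by (auto simp: V0_def)
    qed
    \<comment> \<open>With \<open>\<alpha>\<close> kept after \<open>T0\<close>,
      \<open>splice\<close> compares only the controls before \<open>T0\<close>, against the
      terminal cost \<open>h\<close>.\<close>
    moreover have "\<alpha> \<in> M_state_trunc T A q F T0 \<psi> t \<mu>"
      unfolding M_state_trunc_iff[OF bdd T0(1) times(2) m_def]
      using \<alpha> splice[OF _ \<alpha>] by (simp add: \<psi>_def split flip: h_def)
    moreover have "f = (\<lambda>x. J_trunc T q F T0 \<psi> t \<mu> \<alpha> x \<alpha>)"
      using T0 times split by (simp add: f J_def J_flow_eq_cost J_trunc_eq_cost \<psi>_def g_def m_def)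
    ultimately show "f \<in> {(\<lambda>x. J_trunc T q F T0 \<psi> t \<mu> \<alpha> x \<alpha>) | \<psi> \<alpha>.
       \<psi> \<in> L0_terminal \<and> \<alpha> \<in> A_state T A \<and>
       (\<lambda>x. \<psi> x (mf_flow T q t \<mu> \<alpha> T0)) \<in> V0 T A q F G T0 (mf_flow T q t \<mu> \<alpha> T0) \<and>
       \<alpha> \<in> M_state_trunc T A q F T0 \<psi> t \<mu>}"
      using \<alpha> unfolding m_def by blast
  next
    fix f assume "f \<in> {(\<lambda>x. J_trunc T q F T0 \<psi> t \<mu> \<alpha> x \<alpha>) | \<psi> \<alpha>.
       \<psi> \<in> L0_terminal \<and> \<alpha> \<in> A_state T A \<and>
       (\<lambda>x. \<psi> x (mf_flow T q t \<mu> \<alpha> T0)) \<in> V0 T A q F G T0 (mf_flow T q t \<mu> \<alpha> T0) \<and>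
       \<alpha> \<in> M_state_trunc T A q F T0 \<psi> t \<mu>}"
    then obtain \<psi> \<alpha> where f: "f = (\<lambda>x. J_trunc T q F T0 \<psi> t \<mu> \<alpha> x \<alpha>)"
      and \<psi>: "(\<lambda>x. \<psi> x (mf_flow T q t \<mu> \<alpha> T0)) \<in> V0 T A q F G T0 (mf_flow T q t \<mu> \<alpha> T0)"
      and M: "\<alpha> \<in> M_state_trunc T A q F T0 \<psi> t \<mu>"
      by auto
    define m1 where "m1 = mf_flow T q t \<mu> \<alpha>"
    from \<psi> obtain \<beta> where h: "(\<lambda>x. \<psi> x (m1 T0)) = (\<lambda>x. J T q F G T0 (m1 T0) \<beta> x \<beta>)"
      and M': "\<beta> \<in> M_state T A q F G T0 (m1 T0)"
      by (auto simp: V0_def m1_def)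
    define m2 where "m2 = mf_flow T q T0 (m1 T0) \<beta>"
    define g where "g = (\<lambda>y. G y (m2 T))"
    have h: "(\<lambda>x. \<psi> x (m1 T0)) = cost q F m2 \<beta> T0 (T - T0) g"
      unfolding h using times by (simp add: J_def J_flow_eq_cost g_def m2_def)
    have \<alpha>: "\<alpha> \<in> A_state T A" and opt1:
      "\<And>x \<gamma>. \<gamma> \<in> A_state T A \<Longrightarrow> cost q F m1 \<alpha> t (T0 - t) (cost q F m2 \<beta> T0 (T - T0) g) x
        \<le> cost q F m1 \<gamma> t (T0 - t) (cost q F m2 \<beta> T0 (T - T0) g) x"
      using M M_state_trunc_iff[OF bdd T0(1) times(2) m1_def, where \<psi> = \<psi>] by (auto simp: h)
    have \<beta>: "\<beta> \<in> A_state T A" and opt2: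
      "\<And>x \<gamma>. \<gamma> \<in> A_state T A \<Longrightarrow> cost q F m2 \<beta> T0 (T - T0) g x
        \<le> cost q F m2 \<gamma> T0 (T - T0) g x"
      using M' M_state_iff[OF bdd times(2) m2_def, where G = G] by (auto simp: g_def)
    define \<delta> where "\<delta> s = (if s < T0 then \<alpha> s else \<beta> s)" for s
    define m where "m = mf_flow T q t \<mu> \<delta>"
    have \<delta>: "\<delta> \<in> A_state T A" using \<alpha> \<beta> by (auto simp: \<delta>_def A_state_def)
    \<comment> \<open>The range includes \<open>T0\<close>, because the law at \<open>T0\<close>
      depends only on controls at earlier times. Hence \<open>m2\<close> starts from
      \<open>m T0\<close>.\<close>
    have m1: "m s = m1 s" if "t \<le> s" "s \<le> T0" for s
      unfolding m_def using that times
      by (intro mf_flow_unique) (auto simp: m1_def mf_law_init mf_flow_Suc \<delta>_def)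
    have m2: "m2 s = m s" if "T0 \<le> s" "s \<le> T" for s
      unfolding m2_def using that T0 m1[of T0]
      by (intro mf_flow_unique) (auto simp: m_def mf_flow_Suc \<delta>_def)
    \<comment> \<open>The flow of the glued control is \<open>m1\<close> up to \<open>T0\<close> and
      \<open>m2\<close> from there on, whichever control \<open>\<gamma>\<close> the single player
      uses.\<close>
    have split: "cost q F m \<gamma> t (T - t) g =
        cost q F m1 \<gamma> t (T0 - t) (cost q F m2 \<gamma> T0 (T - T0) g)" for \<gamma>
    proof -
      have "cost q F m \<gamma> t (T - t) g = cost q F m \<gamma> t (T0 - t) (cost q F m \<gamma> T0 (T - T0) g)"
        by (simp only: cost_split[OF T0(1) times(2)])
      also have "cost q F m \<gamma> T0 (T - T0) g = cost q F m2 \<gamma> T0 (T - T0) g"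
        using m2 by (intro cost_cong) auto
      also have "cost q F m \<gamma> t (T0 - t) \<dots> = cost q F m1 \<gamma> t (T0 - t) \<dots>"
        using m1 by (intro cost_cong) auto
      finally show ?thesis .
    qed
    have split\<delta>: "cost q F m \<delta> t (T - t) g =
        cost q F m1 \<alpha> t (T0 - t) (cost q F m2 \<beta> T0 (T - T0) g)"
    proof -
      have "cost q F m2 \<delta> T0 (T - T0) g = cost q F m2 \<beta> T0 (T - T0) g"
        by (intro cost_cong) (auto simp: \<delta>_def)
      moreover have "cost q F m1 \<delta> t (T0 - t) h = cost q F m1 \<alpha> t (T0 - t) h" for h
        by (intro cost_cong) (auto simp: \<delta>_def)
      ultimately show ?thesis by (simp add: split)
    qed
    have g: "(\<lambda>y. G y (m T)) = g" using m2[OF times(2) order_refl] by (simp add: g_def)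
    \<comment> \<open>First \<open>\<alpha>\<close> is replaced by \<open>\<gamma>\<close> before
      \<open>T0\<close> with the continuation of \<open>\<beta>\<close> kept, by truncated
      optimality; then monotonicity allows the continuation to be replaced by that of
      \<open>\<gamma>\<close>.\<close>
    have "cost q F m \<delta> t (T - t) g x \<le> cost q F m \<gamma> t (T - t) g x"
      if \<gamma>: "\<gamma> \<in> A_state T A" for \<gamma> x
      unfolding split\<delta> split[of \<gamma>]
      by (rule order_trans[OF opt1[OF \<gamma>] cost_mono[OF opt2[OF \<gamma>]]])
    then have "\<delta> \<in> M_state T A q F G t \<mu>"
      unfolding M_state_iff[OF bdd T0(2) m_def] g using \<delta> by blast
    moreover have "f = (\<lambda>x. J T q F G t \<mu> \<delta> x \<delta>)"
      using T0 times split\<delta> by (simp add: f J_def J_flow_eq_cost J_trunc_eq_cost h g flip: m_def m1_def)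
    ultimately show "f \<in> V0 T A q F G t \<mu>"
      by (auto simp: V0_def)
  }
qed

end
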